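(* Let $\mathcal M_d=(Q,H_d,\phi_d)$ be a forced discrete Hamiltonian system. A discrete curve $(q_\cdot,p_\cdot)=((q_0,p_0),\dots,(q_N,p_N))$ in $T^*Q$ is a (type II) trajectory of $\mathcal M_d$ if and only if it satisfies $$\begin{cases} q_k=D_2H_d(q_{k-1},p_k)-\phi_d^p(q_{k-1},p_k),\\ p_k=D_1H_d(q_k,p_{k+1})-\phi_d^q(q_k,p_{k+1}),\end{cases}\qquad k=1,\dots,N-1.$$
   Context: $Q$ is a finite-dimensional real vector space and $T^*Q\simeq Q\times Q^*$. A forced discrete Hamiltonian system is a triple $(Q,H_d,\phi_d)$ with $H_d:T^*Q\to\mathbb R$ smooth and $\phi_d$ a 1-form on $T^*Q$, decomposed as $\phi_d(q,p)(\delta q,\delta p)=\phi_d^q(q,p)(\delta q)+\phi_d^p(q,p)(\delta p)$. A discrete curve $((q_0,p_0),\dots,(q_N,p_N))$ in $T^*Q$ is a type II trajectory if $$\delta\Big(p_Nq_N-\sum_{k=0}^{N-1}\big(p_{k+1}q_{k+1}-H_d(q_k,p_{k+1})\big)\Big)-\sum_{k=0}^{N-1}\phi_d(q_k,p_{k+1})(\delta q_k,\delta p_{k+1})=0$$ for all infinitesimal variations $(\delta q_\cdot,\delta p_\cdot)=((\delta q_0,\delta p_0),\dots,(\delta q_N,\delta p_N))\in(Q\times Q^* )^{N+1}$ with $\delta q_0=0$ and $\delta p_N=0$, where $\delta(\cdot)$ is the derivative of the expression in parentheses, as a function of $(q_\cdot,p_\cdot)$, in the direction $(\delta q_\cdot,\delta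 p_\cdot)$. *)

theory Defs
  imports "HOL-Analysis.Analysis"
begin

text \<open>
  A finite-dimensional real vector space is modelled by a real normed space that is spanned by a
  finite set.  Such a space carries a norm, any two norms on it are equivalent and every linear
  functional on it is bounded; hence differentiability and smoothness do not depend on the norm,
  and the bounded functionals form the full algebraic dual.
\<close>

definition finite_dim_space :: "'q::real_normed_vector itself \<Rightarrow> bool" where
  "finite_dim_space _ \<longleftrightarrow> (\<exists>B::'q set. finite B \<and> span B = UNIV)"

type_synonym 'q dual = "'q \<Rightarrow>\<^sub>L real"

type_synonym 'q cotangent = "'q \<times> 'q dual"

type_synonym 'q one_form = "'q cotangent \<Rightarrow> 'q cotangent \<Rightarrow>\<^sub>L real"

text \<open>
  Being \<open>n\<close> times continuously differentiable, expressed through iterated directional derivatives.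
  On a finite-dimensional domain, continuity of all the maps \<open>x \<mapsto> Df(x) v\<close> is continuity of \<open>Df\<close>,
  so this is the usual notion.
\<close>

primrec continuously_diff :: "nat \<Rightarrow> ('a::real_normed_vector \<Rightarrow> 'b::real_normed_vector) \<Rightarrow> bool" where
  "continuously_diff 0 f \<longleftrightarrow> continuous_on UNIV f"
| "continuously_diff (Suc n) f \<longleftrightarrow>
     (\<forall>x. f differentiable (at x)) \<and>
     (\<forall>v. continuously_diff n (\<lambda>x. frechet_derivative f (at x) v))"

definition smooth_map :: "('a::real_normed_vector \<Rightarrow> 'b::real_normed_vector) \<Rightarrow> bool" where
  "smooth_map f \<longleftrightarrow> (\<forall>n. continuously_diff n f)"

definition D1 :: "('q::real_normed_vector cotangent \<Rightarrow> real) \<Rightarrow> 'q cotangent \<Rightarrow> 'q dual" where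
  "D1 H = (\<lambda>(q, p). Blinfun (frechet_derivative (\<lambda>x. H (x, p)) (at q)))"

definition D2 :: "('q::real_normed_vector cotangent \<Rightarrow> real) \<Rightarrow> 'q cotangent \<Rightarrow> 'q dual dual" where
  "D2 H = (\<lambda>(q, p). Blinfun (frechet_derivative (\<lambda>y. H (q, y)) (at p)))"

definition form_q :: "'q::real_normed_vector one_form \<Rightarrow> 'q cotangent \<Rightarrow> 'q dual" where
  "form_q \<phi> z = Blinfun (\<lambda>dq. \<phi> z (dq, 0))"

definition form_p :: "'q::real_normed_vector one_form \<Rightarrow> 'q cotangent \<Rightarrow> 'q dual dual" where
  "form_p \<phi> z = Blinfun (\<lambda>dp. \<phi> z (0, dp))"

text \<open>
  The canonical map \<open>Q \<rightarrow> Q\<^sup>*\<^sup>*\<close>, bijective for finite-dimensional \<open>Q\<close>.  The partial derivative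
  \<open>D2 H\<close> and the component \<open>form_p \<phi>\<close> are functionals on \<open>Q\<^sup>*\<close>; comparing them with a point of
  \<open>Q\<close> goes through this identification.
\<close>

definition to_bidual :: "'q::real_normed_vector \<Rightarrow> 'q dual dual" where
  "to_bidual q = Blinfun (\<lambda>p. blinfun_apply p q)"

lemma to_bidual_apply: "to_bidual q p = blinfun_apply p q"
  unfolding to_bidual_def by (simp add: bounded_linear_Blinfun_apply blinfun.bounded_linear_left)

lemma form_q_apply:
  fixes \<phi> :: "'q::real_normed_vector one_form"
  shows "form_q \<phi> z dq = \<phi> z (dq, 0)"
proof -
  have "bounded_linear (\<lambda>dq. \<phi> z (dq, 0))"
    by (intro bounded_linear_compose[OF blinfun.bounded_linear_right] bounded_linear_Pair
        bounded_linear_ident bounded_linear_zero)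
  then show ?thesis
    unfolding form_q_def by (simp add: bounded_linear_Blinfun_apply)
qed

lemma form_p_apply:
  fixes \<phi> :: "'q::real_normed_vector one_form"
  shows "form_p \<phi> z dp = \<phi> z (0, dp)"
proof -
  have "bounded_linear (\<lambda>dp. \<phi> z (0, dp))"
    by (intro bounded_linear_compose[OF blinfun.bounded_linear_right] bounded_linear_Pair
        bounded_linear_ident bounded_linear_zero)
  then show ?thesis
    unfolding form_p_def by (simp add: bounded_linear_Blinfun_apply)
qed

lemma form_decomposition:
  fixes \<phi> :: "'q::real_normed_vector one_form"
  shows "\<phi> z (dq, dp) = form_q \<phi> z dq + form_p \<phi> z dp"
  by (simp add: form_q_apply form_p_apply flip: blinfun.add_right)

text \<open>
  A discrete curve \<open>((q\<^sub>0, p\<^sub>0), \<dots>, (q\<^sub>N, p\<^sub>N))\<close> is given by functions \<open>q\<close> and \<open>p\<close> on the natural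
  numbers, of which only the values at \<open>0, \<dots>, N\<close> are used; likewise for variations.
\<close>

definition type_II_action ::
  "nat \<Rightarrow> ('q::real_normed_vector cotangent \<Rightarrow> real) \<Rightarrow> (nat \<Rightarrow> 'q) \<Rightarrow> (nat \<Rightarrow> 'q dual) \<Rightarrow> real"
where
  "type_II_action N H q p =
     p N (q N) - (\<Sum>k<N. p (Suc k) (q (Suc k)) - H (q k, p (Suc k)))"

definition type_II_trajectory ::
  "nat \<Rightarrow> ('q::real_normed_vector cotangent \<Rightarrow> real) \<Rightarrow> 'q one_form \<Rightarrow>
     (nat \<Rightarrow> 'q) \<Rightarrow> (nat \<Rightarrow> 'q dual) \<Rightarrow> bool"
where
  "type_II_trajectory N H \<phi> q p \<longleftrightarrow>
     (\<forall>dq dp. dq 0 = 0 \<and> dp N = 0 \<longrightarrow>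
        deriv (\<lambda>t. type_II_action N H (\<lambda>k. q k + t *\<^sub>R dq k) (\<lambda>k. p k + t *\<^sub>R dp k)) 0
        - (\<Sum>k<N. \<phi> (q k, p (Suc k)) (dq k, dp (Suc k))) = 0)"

end

theory Submission
  imports Defs
begin

text \<open>
  In the action the boundary term \<open>p\<^sub>N q\<^sub>N\<close> cancels against the last summand.  Differentiating and
  collecting the coefficients of \<open>\<delta>q\<^sub>k\<close> and \<open>\<delta>p\<^sub>k\<close>, a discrete summation by parts using
  \<open>\<delta>q\<^sub>0 = 0\<close> and \<open>\<delta>p\<^sub>N = 0\<close>, leaves exactly the interior indices \<open>0 < k < N\<close>; varying one entry of
  the curve at a time then isolates each equation.
\<close>

lemma smooth_map_differentiable: "smooth_map f \<Longrightarrow> f differentiable (at x)"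
  unfolding smooth_map_def by (metis continuously_diff.simps(2))

text \<open>The chain rule for the affine inclusion \<open>u\<close> to \<open>(u, y)\<close>. It
  also shows that the partial derivative is bounded, so \<open>Blinfun\<close> returns it and not an
  unspecified value.\<close>

lemma D1_apply:
  fixes H :: "'q::real_normed_vector cotangent \<Rightarrow> real"
  assumes "H differentiable (at (x, y))"
  shows "D1 H (x, y) v = frechet_derivative H (at (x, y)) (v, 0)"
proof -
  have "(H has_derivative frechet_derivative H (at (x, y))) (at (x, y))"
    using assms by (simp add: frechet_derivative_works)
  then have *: "((\<lambda>u. H (u, y)) has_derivative (\<lambda>u. frechet_derivative H (at (x, y)) (u, 0))) (at x)"
    by (rule has_derivative_compose[where f="\<lambda>u. (u, y)", rotated]) (auto intro!: derivative_eq_intros)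
  then show ?thesis
    by (simp add: D1_def bounded_linear_Blinfun_apply has_derivative_bounded_linear
        flip: frechet_derivative_at[OF *])
qed

lemma D2_apply:
  fixes H :: "'q::real_normed_vector cotangent \<Rightarrow> real"
  assumes "H differentiable (at (x, y))"
  shows "D2 H (x, y) v = frechet_derivative H (at (x, y)) (0, v)"
proof -
  have "(H has_derivative frechet_derivative H (at (x, y))) (at (x, y))"
    using assms by (simp add: frechet_derivative_works)
  then have *: "((\<lambda>u. H (x, u)) has_derivative (\<lambda>u. frechet_derivative H (at (x, y)) (0, u))) (at y)"
    by (rule has_derivative_compose[where f="\<lambda>u. (x, u)", rotated]) (auto intro!: derivative_eq_intros)
  then show ?thesis
    by (simp add: D2_def bounded_linear_Blinfun_apply has_derivative_bounded_linear
        flip: frechet_derivative_at[OF *])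
qed

lemma has_real_derivative_along_line:
  fixes H :: "'q::real_normed_vector cotangent \<Rightarrow> real"
  assumes "H differentiable (at (x, y))"
  shows "((\<lambda>t. H (x + t *\<^sub>R v, y + t *\<^sub>R w)) has_real_derivative D1 H (x, y) v + D2 H (x, y) w) (at 0)"
proof -
  let ?D = "frechet_derivative H (at (x, y))"
  have D: "(H has_derivative ?D) (at (x, y))"
    using assms by (simp add: frechet_derivative_works)
  then interpret bounded_linear ?D by (rule has_derivative_bounded_linear)
  have "((\<lambda>t. (x + t *\<^sub>R v, y + t *\<^sub>R w)) has_derivative (\<lambda>t. (t *\<^sub>R v, t *\<^sub>R w))) (at (0::real))"
    by (auto intro!: derivative_eq_intros)
  \<comment> \<open>The base point is written as the value of the line at \<open>t = 0\<close>, the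
    form in which the chain rule asks for it.\<close>
  moreover have "(H has_derivative ?D) (at (x + 0 *\<^sub>R v, y + 0 *\<^sub>R w))"
    using D by simp
  ultimately have "((\<lambda>t. H (x + t *\<^sub>R v, y + t *\<^sub>R w)) has_derivative (\<lambda>t. ?D (t *\<^sub>R v, t *\<^sub>R w))) (at 0)"
    by (rule has_derivative_compose)
  moreover have "?D (t *\<^sub>R v, t *\<^sub>R w) = (D1 H (x, y) v + D2 H (x, y) w) * t" for t
    using scaleR[of t "(v, w)"] add[of "(v, 0)" "(0, w)"]
    by (simp add: D1_apply[OF assms] D2_apply[OF assms] mult.commute)
  ultimately show ?thesis
    by (simp add: has_field_derivative_def)
qed

text \<open>Along a line the pairing is a quadratic polynomial in \<open>t\<close>, and its
  derivative at 0 is the linear coefficient.\<close>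

lemma has_real_derivative_pairing:
  fixes x v :: "'q::real_normed_vector" and y w :: "'q dual"
  shows "((\<lambda>t. (y + t *\<^sub>R w) (x + t *\<^sub>R v)) has_real_derivative w x + y v) (at 0)"
proof -
  have eq: "(y + t *\<^sub>R w) (x + t *\<^sub>R v) = y x + t * (w x + y v) + t * t * w v" for t
    by (simp add: blinfun.bilinear_simps algebra_simps)
  show ?thesis
    unfolding eq by (auto intro!: derivative_eq_intros)
qed

lemma type_II_action_has_real_derivative:
  fixes H :: "'q::real_normed_vector cotangent \<Rightarrow> real"
  assumes "\<And>z. H differentiable (at z)"
  shows "((\<lambda>t. type_II_action N H (\<lambda>k. q k + t *\<^sub>R dq k) (\<lambda>k. p k + t *\<^sub>R dp k)) has_real_derivative
      dp N (q N) + p N (dq N)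
      - (\<Sum>k<N. dp (Suc k) (q (Suc k)) + p (Suc k) (dq (Suc k))
          - (D1 H (q k, p (Suc k)) (dq k) + D2 H (q k, p (Suc k)) (dp (Suc k))))) (at 0)"
  unfolding type_II_action_def
  by (intro DERIV_diff DERIV_sum has_real_derivative_pairing has_real_derivative_along_line assms)

text \<open>The boundary term removes the last \<open>c\<close>, \<open>a 0 = 0\<close> lets the sum
  of \<open>a\<close> start at index 1, and \<open>b M = 0\<close> drops the last \<open>b\<close>.
  In the application \<open>c k\<close> is the variation of the pairing of \<open>p k\<close> with
  \<open>q k\<close>, while \<open>a\<close> and \<open>b\<close> are the parts linear in
  \<open>dq\<close> and \<open>dp\<close>.\<close>

lemma summation_by_parts_interior:
  fixes a b c :: "nat \<Rightarrow> real"
  assumes "a 0 = 0" and "b M = 0"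
  shows "c (Suc M) - (\<Sum>k<Suc M. c (Suc k) - (a k + b k))
    = (\<Sum>k<M. a (Suc k) + b k - c (Suc k))"
proof -
  have "(\<Sum>k<Suc M. a k) = (\<Sum>k<M. a (Suc k))"
    using assms by (simp only: sum.lessThan_Suc_shift)
  then show ?thesis
    using assms by (simp add: sum_subtractf sum.distrib)
qed

text \<open>A discrete fundamental lemma of the calculus of variations: the constraints leave the
  entries of \<open>u\<close> and \<open>v\<close> at the indices 1 to \<open>M\<close>
  free.\<close>

lemma sum_linear_functionals_eq_0_iff:
  fixes f :: "nat \<Rightarrow> 'a::real_normed_vector \<Rightarrow>\<^sub>L real"
    and g :: "nat \<Rightarrow> 'b::real_normed_vector \<Rightarrow>\<^sub>L real"
  shows "(\<forall>u v. u 0 = 0 \<and> v (Suc M) = 0 \<longrightarrow> (\<Sum>k<M. f k (u (Suc k)) + g k (v (Suc k))) = 0)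
    \<longleftrightarrow> (\<forall>k<M. f k = 0 \<and> g k = 0)" (is "?L \<longleftrightarrow> ?R")
proof
  assume L: ?L
  show ?R
  proof (intro allI impI conjI)
    fix k assume k: "k < M"
    show "f k = 0"
    proof (rule blinfun_eqI)
      fix x
      \<comment> \<open>The variation concentrated at \<open>Suc k\<close> is admissible because
        \<open>Suc k\<close> is not 0.\<close>
      have "(\<Sum>j<M. f j (if Suc j = Suc k then x else 0) + g j 0) = 0"
        using L[rule_format, of "\<lambda>j. if j = Suc k then x else 0" "\<lambda>_. 0"] by simp
      moreover have "f j (if Suc j = Suc k then x else 0) + g j 0 = (if j = k then f k x else 0)" for j
        by (simp add: blinfun.zero_right)
      ultimately show "f k x = blinfun_apply 0 x"
        using k by (simp add: sum.delta)
    qed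
    show "g k = 0"
    proof (rule blinfun_eqI)
      fix x
      \<comment> \<open>Here admissibility needs \<open>k < M\<close>, so that the variation
        vanishes at \<open>Suc M\<close>.\<close>
      have "(\<Sum>j<M. f j 0 + g j (if Suc j = Suc k then x else 0)) = 0"
        using L[rule_format, of "\<lambda>_. 0" "\<lambda>j. if j = Suc k then x else 0"] k by simp
      moreover have "f j 0 + g j (if Suc j = Suc k then x else 0) = (if j = k then g k x else 0)" for j
        by (simp add: blinfun.zero_right)
      ultimately show "g k x = blinfun_apply 0 x"
        using k by (simp add: sum.delta)
    qed
  qed
qed simp

theorem proposition3p3:
  fixes H :: "'q::real_normed_vector cotangent \<Rightarrow> real"
    and \<phi> :: "'q one_form"
    and q :: "nat \<Rightarrow> 'q" and p :: "nat \<Rightarrow> 'q dual"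
    and N :: nat
  assumes "finite_dim_space TYPE('q)"
    and "smooth_map H"
  shows "type_II_trajectory N H \<phi> q p \<longleftrightarrow>
    (\<forall>k\<in>{1..<N}.
       to_bidual (q k) = D2 H (q (k - 1), p k) - form_p \<phi> (q (k - 1), p k) \<and>
       p k = D1 H (q k, p (k + 1)) - form_q \<phi> (q k, p (k + 1)))"
proof -
  have diff: "H differentiable (at z)" for z
    using assms(2) by (rule smooth_map_differentiable)
  \<comment> \<open>The action has a derivative along every variation, so \<open>deriv\<close> is
    that derivative and not a default value.\<close>
  note deriv = DERIV_imp_deriv[OF type_II_action_has_real_derivative[OF diff]]
  show ?thesis
  proof (cases N)
    \<comment> \<open>Both endpoint conditions fall on index 0, so the variation vanishes, and there
      are no interior equations.\<close>
    case 0
    then show ?thesis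
      by (simp add: type_II_trajectory_def deriv blinfun.zero_right)
  next
    case (Suc M)
    \<comment> \<open>Both functionals belong to the step from \<open>k\<close> to
      \<open>Suc k\<close>, but \<open>f k\<close> acts on \<open>dq k\<close> and
      \<open>g k\<close> on \<open>dp (Suc k)\<close>. Hence the equations at node
      \<open>Suc k\<close> involve \<open>f (Suc k)\<close> and \<open>g k\<close>.\<close>
    define f where "f k = D1 H (q k, p (Suc k)) - form_q \<phi> (q k, p (Suc k))" for k
    define g where "g k = D2 H (q k, p (Suc k)) - form_p \<phi> (q k, p (Suc k))" for k
    have variation: "deriv (\<lambda>t. type_II_action N H (\<lambda>k. q k + t *\<^sub>R dq k) (\<lambda>k. p k + t *\<^sub>R dp k)) 0
        - (\<Sum>k<N. \<phi> (q k, p (Suc k)) (dq k, dp (Suc k)))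
      = (\<Sum>k<M. (f (Suc k) - p (Suc k)) (dq (Suc k)) + (g k - to_bidual (q (Suc k))) (dp (Suc k)))"
      (is "?lhs = _") if "dq 0 = 0" "dp N = 0" for dq dp
    proof -
      let ?c = "\<lambda>k. dp k (q k) + p k (dq k)"
      have "?lhs = ?c (Suc M) - (\<Sum>k<Suc M. ?c (Suc k) - (f k (dq k) + g k (dp (Suc k))))"
        unfolding deriv form_decomposition Suc f_def g_def
        by (simp only: blinfun.diff_left sum_subtractf sum.distrib)
      \<comment> \<open>The terms lost are \<open>f 0 (dq 0)\<close> and \<open>g M (dp N)\<close>,
        both zero by the endpoint conditions.\<close>
      also have "\<dots> = (\<Sum>k<M. f (Suc k) (dq (Suc k)) + g k (dp (Suc k)) - ?c (Suc k))"
        using that Suc by (intro summation_by_parts_interior) (simp_all add: blinfun.zero_right)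
      also have "\<dots> = (\<Sum>k<M. (f (Suc k) - p (Suc k)) (dq (Suc k))
          + (g k - to_bidual (q (Suc k))) (dp (Suc k)))"
        by (simp add: blinfun.diff_left to_bidual_apply algebra_simps)
      finally show ?thesis .
    qed
    have "type_II_trajectory N H \<phi> q p \<longleftrightarrow>
        (\<forall>dq dp. dq 0 = 0 \<and> dp (Suc M) = 0 \<longrightarrow>
          (\<Sum>k<M. (f (Suc k) - p (Suc k)) (dq (Suc k))
            + (g k - to_bidual (q (Suc k))) (dp (Suc k))) = 0)"
      unfolding type_II_trajectory_def using variation Suc by auto
    also have "\<dots> \<longleftrightarrow> (\<forall>k<M. f (Suc k) - p (Suc k) = 0 \<and> g k - to_bidual (q (Suc k)) = 0)"
      by (rule sum_linear_functionals_eq_0_iff)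
    also have "\<dots> \<longleftrightarrow> (\<forall>k<M. to_bidual (q (Suc k)) = g k \<and> p (Suc k) = f (Suc k))"
      by (metis right_minus_eq)
    \<comment> \<open>Reindexing over the image of \<open>Suc\<close> keeps \<open>k - 1\<close>
      free of truncation at 0.\<close>
    also have "\<dots> \<longleftrightarrow> (\<forall>k\<in>Suc ` {..<M}. to_bidual (q k) = g (k - 1) \<and> p k = f k)"
      by auto
    also have "Suc ` {..<M} = {1..<N}"
      by (simp add: Suc lessThan_atLeast0 image_Suc_atLeastLessThan)
    finally show ?thesis
      by (simp add: f_def g_def)
  qed
qed

end
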